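(* The exchange relations $$\mathsf W_1\,\mathsf I_{2k+1}=\mathsf I'_{2k+1}\,\mathsf W_1\qquad\text{for all }k\in\mathbb N$$ hold in $\mathcal A_q$ if and only if the parameters satisfy $$\bar\varepsilon_+'=\bar\varepsilon_+=0,\qquad\bar\varepsilon_-'=\bar\varepsilon_-,\qquad\frac{\bar k_+}{k_+}=\frac{\bar k_-}{k_-}q^{2},\qquad\bar k_\pm'=\bar k_\pm q^{\mp2}.$$
   Context: $q\in\mathbb C^*$ is not a root of unity, $\mathbb N=\{0,1,\dots\}$, $[X,Y]_q=qXY-q^{-1}YX$. Fix $k_\pm\in\mathbb C^*$, $\rho=k_+k_-(q+q^{-1})^2$. $\mathcal A_q$ is the unital associative $\mathbb C$-algebra generated by $\mathsf W_{-k},\mathsf W_{k+1},\mathsf G_{k+1},\tilde{\mathsf G}_{k+1}$ ($k\in\mathbb N$) with, for all $k,l\in\mathbb N$: $[\mathsf W_0,\mathsf W_{k+1}]=[\mathsf W_{-k},\mathsf W_1]=\frac{\tilde{\mathsf G}_{k+1}-\mathsf G_{k+1}}{q+q^{-1}}$; $[\mathsf W_0,\mathsf G_{k+1}]_q=[\tilde{\mathsf G}_{k+1},\mathsf W_0]_q=\rho(\mathsf W_{-k-1}-\mathsf W_{k+1})$; $[\mathsf G_{k+1},\mathsf W_1]_q=[\mathsf W_1,\tilde{\mathsf G}_{k+1}]_q=\rho(\mathsf W_{k+2}-\mathsf W_{-k})$; $[\mathsf W_{-k},\mathsf W_{-l}]=[\mathsf W_{k+1},\mathsf W_{l+1}]=[\mathsf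 G_{k+1},\mathsf G_{l+1}]=[\tilde{\mathsf G}_{k+1},\tilde{\mathsf G}_{l+1}]=0$; $[\mathsf W_{-k},\mathsf W_{l+1}]+[\mathsf W_{k+1},\mathsf W_{-l}]=0$; $[\mathsf W_{-k},\mathsf G_{l+1}]+[\mathsf G_{k+1},\mathsf W_{-l}]=0$; $[\mathsf W_{-k},\tilde{\mathsf G}_{l+1}]+[\tilde{\mathsf G}_{k+1},\mathsf W_{-l}]=0$; $[\mathsf W_{k+1},\mathsf G_{l+1}]+[\mathsf G_{k+1},\mathsf W_{l+1}]=0$; $[\mathsf W_{k+1},\tilde{\mathsf G}_{l+1}]+[\tilde{\mathsf G}_{k+1},\mathsf W_{l+1}]=0$; $[\tilde{\mathsf G}_{k+1},\mathsf G_{l+1}]+[\mathsf G_{k+1},\tilde{\mathsf G}_{l+1}]=0$. (Known fact: $\mathcal A_q$ has a PBW basis in these generators for the order $\mathsf W_{-k}<\mathsf G_{\ell+1}<\tilde{\mathsf G}_{m+1}<\mathsf W_{n+1}$.) For $\bar\varepsilon_\pm,\bar k_\pm,\bar\varepsilon_\pm',\bar k_\pm'\in\mathbb C$: $\mathsf I_{2k+1}=\bar\varepsilon_+\mathsf W_{-k}+\bar\varepsilon_-\mathsf W_{k+1}+\frac1{q^2-q^{-2}}\Big(\frac{\bar k_-}{k_-}\mathsf G_{k+1}+\frac{\bar k_+}{k_+}\tilde{\mathsf G}_{k+1}\Big)$ and $\mathsf I'_{2k+1}$ is the same expression with $\bar\varepsilon_\pm,\bar k_\pm$ replaced by $\bar\varepsilon_\pm',\bar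 k_\pm'$. *)

theory Defs
  imports
    "HOL-Library.Poly_Mapping"
    "HOL-Algebra.QuotRing"
    "HOL-Algebra.Module"
    "HOL-Algebra.Algebraic_Closure_Type"
begin

section \<open>Unital associative complex algebras given by generators and relations\<close>

text \<open>
  Words under concatenation, written additively so that the convolution product of
  \<^theory>\<open>HOL-Library.Poly_Mapping\<close> makes \<open>'g word \<Rightarrow>\<^sub>0 complex\<close> the free unital
  associative algebra on \<open>'g\<close>.
\<close>

datatype 'g word = Word (letters: "'g list")

instantiation word :: (type) monoid_add
begin
definition zero_word :: "'a word" where "zero_word = Word []"
definition plus_word :: "'a word \<Rightarrow> 'a word \<Rightarrow> 'a word"
  where "plus_word u v = Word (letters u @ letters v)"
instance by standard (simp_all add: zero_word_def plus_word_def)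
end

type_synonym 'g free_alg = "'g word \<Rightarrow>\<^sub>0 complex"

definition gen :: "'g \<Rightarrow> 'g free_alg"
  where "gen g = Poly_Mapping.single (Word [g]) 1"

definition const :: "complex \<Rightarrow> 'g free_alg"
  where "const c = Poly_Mapping.single 0 c"

abbreviation FA :: "'g free_alg ring"
  where "FA \<equiv> ring_of_type_algebra"

text \<open>A pair \<open>(x, y)\<close> in \<open>R\<close> stands for the defining relation \<open>x = y\<close>.\<close>

definition rel_ideal :: "('g free_alg \<times> 'g free_alg) set \<Rightarrow> 'g free_alg set"
  where "rel_ideal R = Idl\<^bsub>FA\<^esub> {x - y | x y. (x, y) \<in> R}"

text \<open>
  The quotient ring of the free algebra, carrying the induced scalar multiplication. A
  \<^typ>\<open>('a, 'b) module\<close> record is used only because it is the ring record with an additional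
  scalar multiplication.
\<close>

definition presented_algebra ::
    "('g free_alg \<times> 'g free_alg) set \<Rightarrow> (complex, 'g free_alg set) module"
  where "presented_algebra R =
    (let J = rel_ideal R; Q = FA Quot J in
      \<lparr>carrier = carrier Q, monoid.mult = monoid.mult Q, monoid.one = monoid.one Q,
       ring.zero = ring.zero Q, ring.add = ring.add Q,
       module.smult = (\<lambda>c Y. (J +>\<^bsub>FA\<^esub> const c) \<otimes>\<^bsub>Q\<^esub> Y)\<rparr>)"

definition cls :: "('g free_alg \<times> 'g free_alg) set \<Rightarrow> 'g free_alg \<Rightarrow> 'g free_alg set"
  where "cls R x = rel_ideal R +>\<^bsub>FA\<^esub> x"


subsection \<open>The presentation does yield an algebra in which the relations hold\<close>

lemma FA_simps [simp]:
  "carrier FA = UNIV" "x \<otimes>\<^bsub>FA\<^esub> y = x * y" "\<one>\<^bsub>FA\<^esub> = 1" "\<zero>\<^bsub>FA\<^esub> = 0" "x \<oplus>\<^bsub>FA\<^esub> y = x + y"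
  by (simp_all add: ring_of_type_algebra_def)

lemma ring_FA: "ring (FA :: 'g free_alg ring)"
proof (rule ringI)
  show "abelian_group (FA :: 'g free_alg ring)"
    by (rule abelian_groupI) (auto simp: algebra_simps intro: exI[of _ "- x" for x])
  show "Group.monoid (FA :: 'g free_alg ring)"
    by (rule monoidI) (auto simp: algebra_simps)
qed (auto simp: algebra_simps)

lemma ideal_rel_ideal: "ideal (rel_ideal R) FA"
  unfolding rel_ideal_def by (intro ring.genideal_ideal ring_FA) simp

lemma presented_algebra_simps:
  "carrier (presented_algebra R) = carrier (FA Quot rel_ideal R)"
  "monoid.mult (presented_algebra R) = monoid.mult (FA Quot rel_ideal R)"
  "monoid.one (presented_algebra R) = monoid.one (FA Quot rel_ideal R)"
  "ring.zero (presented_algebra R) = ring.zero (FA Quot rel_ideal R)"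
  "ring.add (presented_algebra R) = ring.add (FA Quot rel_ideal R)"
  "c \<odot>\<^bsub>presented_algebra R\<^esub> Y = cls R (const c) \<otimes>\<^bsub>presented_algebra R\<^esub> Y"
  by (simp_all add: presented_algebra_def Let_def cls_def)

lemma ring_presented_algebra: "ring (presented_algebra R)"
proof -
  interpret Q: ring "FA Quot rel_ideal R"
    by (rule ideal.quotient_is_ring[OF ideal_rel_ideal])
  show ?thesis
  proof (rule ringI)
    show "abelian_group (presented_algebra R)"
      by (rule abelian_groupI)
         (auto simp: presented_algebra_simps Q.a_ac intro: Q.a_inv_closed Q.l_neg)
    show "Group.monoid (presented_algebra R)"
      by (rule monoidI) (auto simp: presented_algebra_simps Q.m_assoc)
  qed (auto simp: presented_algebra_simps Q.l_distr Q.r_distr)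
qed

lemma cls_hom:
  "cls R x \<in> carrier (presented_algebra R)"
  "cls R (x * y) = cls R x \<otimes>\<^bsub>presented_algebra R\<^esub> cls R y"
  "cls R (x + y) = cls R x \<oplus>\<^bsub>presented_algebra R\<^esub> cls R y"
  "cls R (const c * x) = c \<odot>\<^bsub>presented_algebra R\<^esub> cls R x"
  "cls R 1 = \<one>\<^bsub>presented_algebra R\<^esub>"
proof -
  have h: "cls R \<in> ring_hom FA (FA Quot rel_ideal R)"
    using ideal.rcos_ring_hom[OF ideal_rel_ideal] by (simp add: cls_def[abs_def])
  note m = ring_hom_mult[OF h, simplified] ring_hom_add[OF h, simplified]
    ring_hom_one[OF h, simplified] ring_hom_closed[OF h, simplified]
  show "cls R x \<in> carrier (presented_algebra R)"
    "cls R (x * y) = cls R x \<otimes>\<^bsub>presented_algebra R\<^esub> cls R y"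
    "cls R (x + y) = cls R x \<oplus>\<^bsub>presented_algebra R\<^esub> cls R y"
    "cls R (const c * x) = c \<odot>\<^bsub>presented_algebra R\<^esub> cls R x"
    "cls R 1 = \<one>\<^bsub>presented_algebra R\<^esub>"
    by (simp_all add: presented_algebra_simps m)
qed

lemma cls_eq_iff: "cls R x = cls R y \<longleftrightarrow> x - y \<in> rel_ideal R"
proof -
  interpret F: ring "FA :: 'a free_alg ring" by (rule ring_FA)
  have "\<ominus>\<^bsub>FA\<^esub> y = - y" for y :: "'a free_alg"
    by (rule F.minus_equality) simp_all
  then have "x \<ominus>\<^bsub>FA\<^esub> y = x - y" for x y :: "'a free_alg"
    by (simp add: F.minus_eq)
  then show ?thesis
    using F.quotient_eq_iff_same_a_r_cos[OF ideal_rel_ideal, of x y R] by (simp add: cls_def)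
qed

lemma cls_relation:
  assumes "(x, y) \<in> R"
  shows "cls R x = cls R y"
proof -
  have "{x - y | x y. (x, y) \<in> R} \<subseteq> rel_ideal R"
    unfolding rel_ideal_def by (rule ring.genideal_self[OF ring_FA]) simp
  then show ?thesis using assms by (auto simp: cls_eq_iff)
qed


section \<open>The algebra \<open>A\<^sub>q\<close>\<close>

text \<open>
  The two families \<open>W\<^bsub>-k\<^esub>\<close> and \<open>W\<^bsub>k+1\<^esub>\<close>, \<open>k \<in> \<nat>\<close>, are together indexed by the integers, each
  integer occurring exactly once: \<open>W n\<close> is \<open>W\<^bsub>n\<^esub>\<close>. In contrast, \<open>G k\<close> is \<open>G\<^bsub>k+1\<^esub>\<close>, and \<open>Gt k\<close> is
  \<open>G\<^bsub>k+1\<^esub>\<close> with a tilde.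
\<close>

datatype aq_gen = W int | G nat | Gt nat

definition comm :: "'g free_alg \<Rightarrow> 'g free_alg \<Rightarrow> 'g free_alg"
  where "comm x y = x * y - y * x"

definition qcomm :: "complex \<Rightarrow> 'g free_alg \<Rightarrow> 'g free_alg \<Rightarrow> 'g free_alg"
  where "qcomm q x y = const q * x * y - const (inverse q) * y * x"

definition rho :: "complex \<Rightarrow> complex \<Rightarrow> complex \<Rightarrow> complex"
  where "rho q kp km = kp * km * (q + inverse q)^2"

definition aq_rels :: "complex \<Rightarrow> complex \<Rightarrow> complex \<Rightarrow> (aq_gen free_alg \<times> aq_gen free_alg) set"
  where "aq_rels q kp km =
   (let w = (\<lambda>n. gen (W n)); g = (\<lambda>k. gen (G k)); gt = (\<lambda>k. gen (Gt k)) in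
    (\<Union>k::nat.
      {(comm (w 0) (w (int k + 1)), const (1 / (q + inverse q)) * (gt k - g k)),
       (comm (w (- int k)) (w 1), const (1 / (q + inverse q)) * (gt k - g k)),
       (qcomm q (w 0) (g k), const (rho q kp km) * (w (- int k - 1) - w (int k + 1))),
       (qcomm q (gt k) (w 0), const (rho q kp km) * (w (- int k - 1) - w (int k + 1))),
       (qcomm q (g k) (w 1), const (rho q kp km) * (w (int k + 2) - w (- int k))),
       (qcomm q (w 1) (gt k), const (rho q kp km) * (w (int k + 2) - w (- int k)))}) \<union>
    (\<Union>(k::nat) (l::nat).
      {(comm (w (- int k)) (w (- int l)), 0),
       (comm (w (int k + 1)) (w (int l + 1)), 0),
       (comm (g k) (g l), 0),
       (comm (gt k) (gt l), 0),
       (comm (w (- int k)) (w (int l + 1)) + comm (w (int k + 1)) (w (- int l)), 0),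
       (comm (w (- int k)) (g l) + comm (g k) (w (- int l)), 0),
       (comm (w (- int k)) (gt l) + comm (gt k) (w (- int l)), 0),
       (comm (w (int k + 1)) (g l) + comm (g k) (w (int l + 1)), 0),
       (comm (w (int k + 1)) (gt l) + comm (gt k) (w (int l + 1)), 0),
       (comm (gt k) (g l) + comm (g k) (gt l), 0)}))"

definition Aq :: "complex \<Rightarrow> complex \<Rightarrow> complex \<Rightarrow> (complex, aq_gen free_alg set) module"
  where "Aq q kp km = presented_algebra (aq_rels q kp km)"

definition aq_el :: "complex \<Rightarrow> complex \<Rightarrow> complex \<Rightarrow> aq_gen \<Rightarrow> aq_gen free_alg set"
  where "aq_el q kp km x = cls (aq_rels q kp km) (gen x)"

text \<open>
  \<open>I_odd q kp km ep em bp bm k\<close> is \<open>I\<^bsub>2k+1\<^esub>\<close> with \<open>ep\<close>, \<open>em\<close> the barred epsilons and \<open>bp\<close>, \<open>bm\<close>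
  the barred \<open>k\<close>'s; \<open>kp\<close>, \<open>km\<close> are the unbarred \<open>k\<close>'s.
\<close>

definition I_odd :: "complex \<Rightarrow> complex \<Rightarrow> complex \<Rightarrow> complex \<Rightarrow> complex \<Rightarrow> complex \<Rightarrow> complex \<Rightarrow>
    nat \<Rightarrow> aq_gen free_alg set"
  where "I_odd q kp km ep em bp bm k =
    (let A = Aq q kp km; x = aq_el q kp km in
      ep \<odot>\<^bsub>A\<^esub> x (W (- int k)) \<oplus>\<^bsub>A\<^esub> em \<odot>\<^bsub>A\<^esub> x (W (int k + 1)) \<oplus>\<^bsub>A\<^esub>
      (1 / (q^2 - inverse q ^ 2)) \<odot>\<^bsub>A\<^esub>
        ((bm / km) \<odot>\<^bsub>A\<^esub> x (G k) \<oplus>\<^bsub>A\<^esub> (bp / kp) \<odot>\<^bsub>A\<^esub> x (Gt k)))"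

end

theory Submission
  imports Defs
begin

text \<open>
  Write \<open>K = 1 / (q\<^sup>2 - q\<^bsup>-2\<^esup>)\<close>, \<open>M = bm / km\<close>, \<open>P = bp / kp\<close>, \<open>M' = bm' / km\<close>, \<open>P' = bp' / kp\<close>, and
  \<open>Gt\<^bsub>k+1\<^esub>\<close> for \<open>G\<^bsub>k+1\<^esub>\<close> with a tilde.

  Sufficiency. The \<open>q\<close>-commutators \<open>[G\<^bsub>k+1\<^esub>, W\<^sub>1]\<^sub>q\<close> and \<open>[W\<^sub>1, Gt\<^bsub>k+1\<^esub>]\<^sub>q\<close> have the same value
  \<open>\<rho> (W\<^bsub>k+2\<^esub> - W\<^bsub>-k\<^esub>)\<close>. If the parameters satisfy the stated conditions, then
  \<open>W\<^sub>1 I\<^bsub>2k+1\<^esub> - I'\<^bsub>2k+1\<^esub> W\<^sub>1\<close> is \<open>K M q ([W\<^sub>1, Gt\<^bsub>k+1\<^esub>]\<^sub>q - [G\<^bsub>k+1\<^esub>, W\<^sub>1]\<^sub>q) - em [W\<^bsub>k+1\<^esub>, W\<^sub>1]\<close>, hence zero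
  (lemma \<open>parameters_imp_exchange\<close>).

  Necessity. No PBW basis is needed: it suffices to look at the exchange relation for \<open>k = 0\<close> in a
  family of two-dimensional representations. For every point \<open>(b1, b2)\<close> of the conic
  \<open>b1\<^sup>2 + b2\<^sup>2 - (q\<^sup>2 + q\<^bsup>-2\<^esup>) b1 b2 = \<rho>\<close> there is a representation with \<open>W\<^sub>1 = diag(b1, b2)\<close>, with \<open>W\<^sub>0\<close>,
  \<open>G\<^sub>1\<close> and \<open>Gt\<^sub>1\<close> off-diagonal, and in which all other generators are scalars
  (lemma \<open>aq_rep_relations\<close>). The entries of the exchange relation then give \<open>em b1\<^sup>2 = em' b1\<^sup>2\<close> and
  \<open>b1 (ep + K (M g + P h)) = (ep' + K (M' g + P' h)) b2\<close> with \<open>g = q b1 - q\<^bsup>-1\<^esup> b2\<close> and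
  \<open>h = q b2 - q\<^bsup>-1\<^esup> b1\<close>, for all such points. The points
  \<open>(r, 0)\<close>, \<open>(-r, 0)\<close>, \<open>(0, r)\<close>, \<open>(0, -r)\<close> with \<open>r\<^sup>2 = \<rho>\<close> and one point \<open>(t, t)\<close> already force all the
  conditions (lemma \<open>exchange_imp_parameters\<close>).
\<close>

section \<open>Evaluating the free algebra\<close>

lemma poly_mapping_single_add_induct [case_names zero single_add]:
  assumes "P 0" "\<And>p w c. P p \<Longrightarrow> P (Poly_Mapping.single w c + p)"
  shows "P p"
proof (induction p rule: update_induct)
  case (update p w c)
  then have "Poly_Mapping.update w c p = Poly_Mapping.single w c + p"
    by (intro poly_mapping_eqI) (auto simp: lookup_update lookup_add lookup_single in_keys_iff when_def)
  with update assms(2) show ?case by simp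
qed (fact assms(1))

text \<open>
  A ring homomorphism from the complex numbers into the centre of a unital ring, that is, the
  structure of a unital complex algebra on that ring.
\<close>

locale central_scalars =
  fixes \<sigma> :: "complex \<Rightarrow> 'a::ring_1"
  assumes scal_add: "\<sigma> (a + b) = \<sigma> a + \<sigma> b"
    and scal_mult: "\<sigma> (a * b) = \<sigma> a * \<sigma> b"
    and scal_one: "\<sigma> 1 = 1"
    and scal_central: "\<sigma> a * x = x * \<sigma> a"
begin

lemma scal_zero: "\<sigma> 0 = 0"
  using scal_add[of 0 0] by simp

text \<open>The product of the values of the letters of a word, in order.\<close>

definition word_eval :: "('g \<Rightarrow> 'a) \<Rightarrow> 'g word \<Rightarrow> 'a"
  where "word_eval f w = prod_list (map f (letters w))"

text \<open>
  The algebra homomorphism out of the free algebra that extends a given assignment of values to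
  the generators.
\<close>

definition free_eval :: "('g \<Rightarrow> 'a) \<Rightarrow> 'g free_alg \<Rightarrow> 'a"
  where "free_eval f p = (\<Sum>w\<in>Poly_Mapping.keys p. \<sigma> (Poly_Mapping.lookup p w) * word_eval f w)"

lemma word_eval_plus: "word_eval f (u + v) = word_eval f u * word_eval f v"
  by (simp add: word_eval_def plus_word_def)

lemma free_eval_superset:
  assumes "finite S" "Poly_Mapping.keys p \<subseteq> S"
  shows "free_eval f p = (\<Sum>w\<in>S. \<sigma> (Poly_Mapping.lookup p w) * word_eval f w)"
  unfolding free_eval_def
  by (rule sum.mono_neutral_left) (use assms in \<open>auto simp: scal_zero in_keys_iff\<close>)

lemma free_eval_add: "free_eval f (p + r) = free_eval f p + free_eval f r"
proof -
  let ?S = "Poly_Mapping.keys p \<union> Poly_Mapping.keys r"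
  have "free_eval f x = (\<Sum>w\<in>?S. \<sigma> (Poly_Mapping.lookup x w) * word_eval f w)"
    if "Poly_Mapping.keys x \<subseteq> ?S" for x
    using that by (intro free_eval_superset) auto
  then show ?thesis
    using Poly_Mapping.keys_add[of p r]
    by (simp add: lookup_add scal_add distrib_right sum.distrib)
qed

lemma free_eval_single: "free_eval f (Poly_Mapping.single w c) = \<sigma> c * word_eval f w"
  by (simp add: free_eval_def scal_zero)

lemma free_eval_zero: "free_eval f 0 = 0"
  by (simp add: free_eval_def)

lemma free_eval_mult: "free_eval f (p * r) = free_eval f p * free_eval f r"
proof (induction p rule: poly_mapping_single_add_induct)
  case (single_add p u a)
  have "free_eval f (Poly_Mapping.single u a * r) = \<sigma> a * word_eval f u * free_eval f r" for r
  proof (induction r rule: poly_mapping_single_add_induct)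
    case (single_add r v b)
    have "\<sigma> a * \<sigma> b * (word_eval f u * word_eval f v)
        = \<sigma> a * word_eval f u * (\<sigma> b * word_eval f v)"
      by (metis mult.assoc scal_central)
    with single_add show ?case
      by (simp add: distrib_left free_eval_add mult_single free_eval_single scal_mult word_eval_plus)
  qed (simp add: free_eval_zero)
  with single_add show ?case
    by (simp add: distrib_right free_eval_add free_eval_single)
qed (simp add: free_eval_zero)

lemma free_eval_diff: "free_eval f (p - r) = free_eval f p - free_eval f r"
  using free_eval_add[of f "p - r" r] by simp

lemma free_eval_gen: "free_eval f (gen g) = f g"
  by (simp add: gen_def free_eval_single word_eval_def scal_one)

lemma free_eval_const: "free_eval f (const c) = \<sigma> c"
  by (simp add: const_def free_eval_single word_eval_def zero_word_def)

lemmas free_eval_hom = free_eval_add free_eval_diff free_eval_mult free_eval_gen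
  free_eval_const free_eval_zero

text \<open>
  An assignment that satisfies the relations factors through the presented algebra, because the
  kernel of \<open>free_eval f\<close> is a two-sided ideal containing the relators.
\<close>

lemma free_eval_respects_cls:
  fixes f :: "'g \<Rightarrow> 'a"
  assumes rels: "\<And>x y. (x, y) \<in> R \<Longrightarrow> free_eval f x = free_eval f y"
    and eq: "cls R x = cls R y"
  shows "free_eval f x = free_eval f y"
proof -
  interpret F: ring "FA :: 'g free_alg ring" by (rule ring_FA)
  have minus: "\<ominus>\<^bsub>FA\<^esub> p = - p" for p :: "'g free_alg"
    by (rule F.minus_equality) simp_all
  have "ideal {p. free_eval f p = 0} (FA :: 'g free_alg ring)"
  proof (rule idealI[OF ring_FA])
    show "subgroup {p. free_eval f p = 0} (add_monoid (FA :: 'g free_alg ring))"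
      by (rule F.add.subgroupI)
         (use free_eval_diff[of f 0] in \<open>auto simp: minus free_eval_add free_eval_zero intro: exI[of _ 0]\<close>)
  qed (simp_all add: free_eval_mult)
  then have "rel_ideal R \<subseteq> {p. free_eval f p = 0}"
    unfolding rel_ideal_def
    by (rule F.genideal_minimal) (use rels in \<open>auto simp: free_eval_diff\<close>)
  then show ?thesis
    using eq by (auto simp: cls_eq_iff free_eval_diff)
qed

end

section \<open>Two-by-two matrices\<close>

text \<open>Complex two-by-two matrices as a ring; the entries are listed row by row.\<close>

datatype mat2 = Mat2 complex complex complex complex

instantiation mat2 :: ring_1
begin
definition zero_mat2 :: mat2 where "0 = Mat2 0 0 0 0"
definition one_mat2 :: mat2 where "1 = Mat2 1 0 0 1"
fun plus_mat2 :: "mat2 \<Rightarrow> mat2 \<Rightarrow> mat2"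
  where "Mat2 a b c d + Mat2 a' b' c' d' = Mat2 (a + a') (b + b') (c + c') (d + d')"
fun minus_mat2 :: "mat2 \<Rightarrow> mat2 \<Rightarrow> mat2"
  where "Mat2 a b c d - Mat2 a' b' c' d' = Mat2 (a - a') (b - b') (c - c') (d - d')"
fun uminus_mat2 :: "mat2 \<Rightarrow> mat2"
  where "- Mat2 a b c d = Mat2 (- a) (- b) (- c) (- d)"
fun times_mat2 :: "mat2 \<Rightarrow> mat2 \<Rightarrow> mat2"
  where "Mat2 a b c d * Mat2 a' b' c' d' =
    Mat2 (a * a' + b * c') (a * b' + b * d') (c * a' + d * c') (c * b' + d * d')"
instance
proof
  fix x y z :: mat2
  show "x * y * z = x * (y * z)" "(x + y) * z = x * z + y * z" "x * (y + z) = x * y + x * z"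
    "x + y + z = x + (y + z)" "x + y = y + x" "0 + x = x" "- x + x = 0" "x - y = x + - y"
    "1 * x = x" "x * 1 = x"
    by (cases x; cases y; cases z; simp add: zero_mat2_def one_mat2_def algebra_simps)+
  show "(0::mat2) \<noteq> 1" by (simp add: zero_mat2_def one_mat2_def)
qed
end

definition scalar2 :: "complex \<Rightarrow> mat2"
  where "scalar2 c = Mat2 c 0 0 c"

interpretation mat2: central_scalars scalar2
proof
  show "scalar2 a * x = x * scalar2 a" for a x
    by (cases x) (simp add: scalar2_def)
qed (simp_all add: scalar2_def one_mat2_def)

section \<open>Two-dimensional representations\<close>

text \<open>
  With \<open>W\<^sub>1 = diag(b1, b2)\<close> and \<open>W\<^sub>0\<close> off-diagonal with entries \<open>kp\<close>, \<open>km\<close> (so that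
  \<open>W\<^sub>0\<^sup>2 = kp km\<close>), \<open>G\<^sub>1\<close> is \<open>q W\<^sub>1 W\<^sub>0 - q\<^bsup>-1\<^esup> W\<^sub>0 W\<^sub>1\<close> and \<open>Gt\<^sub>1\<close> is
  \<open>q W\<^sub>0 W\<^sub>1 - q\<^bsup>-1\<^esup> W\<^sub>1 W\<^sub>0\<close>. The higher \<open>G\<close> and \<open>Gt\<close> vanish, and the relations then force
  every \<open>W\<^sub>n\<close> other than \<open>W\<^sub>0\<close> and \<open>W\<^sub>1\<close> to be a scalar depending only on the parity of \<open>n\<close>. This is
  a representation when \<open>(b1, b2)\<close> lies on the conic of the next lemma.
\<close>

definition aq_rep :: "complex \<Rightarrow> complex \<Rightarrow> complex \<Rightarrow> complex \<Rightarrow> complex \<Rightarrow> aq_gen \<Rightarrow> mat2"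
  where "aq_rep q kp km b1 b2 x = (case x of
      W n \<Rightarrow> if n = 0 then Mat2 0 kp km 0
             else if n = 1 then Mat2 b1 0 0 b2
             else if odd n then scalar2 ((q^2 + inverse q^2) * (b1 + b2) / (q + inverse q)^2)
             else 0
    | G k \<Rightarrow> if k = 0 then Mat2 0 (kp * (q * b1 - inverse q * b2)) (km * (q * b2 - inverse q * b1)) 0
             else 0
    | Gt k \<Rightarrow> if k = 0 then Mat2 0 (kp * (q * b2 - inverse q * b1)) (km * (q * b1 - inverse q * b2)) 0
             else 0)"

lemma aq_rep_relations:
  assumes q: "q \<noteq> 0" "q + inverse q \<noteq> 0"
    and conic: "b1^2 + b2^2 - (q^2 + inverse q^2) * b1 * b2 = kp * km * (q + inverse q)^2"
    and rel: "(x, y) \<in> aq_rels q kp km"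
  shows "mat2.free_eval (aq_rep q kp km b1 b2) x = mat2.free_eval (aq_rep q kp km b1 b2) y"
proof -
  define a where "a = (q^2 + inverse q^2) * (b1 + b2) / (q + inverse q)^2"
  define p where "p = inverse q"
  have qp: "q * p = 1" "p * q = 1" and s0: "q + p \<noteq> 0"
    using q by (simp_all add: p_def)
  have a: "a * (q + p)^2 = (q^2 + p^2) * (b1 + b2)"
    using s0 by (simp add: a_def p_def)
  note c = conic[folded p_def]
  let ?r = "aq_rep q kp km b1 b2"
  define A0 where "A0 = Mat2 0 kp km 0"
  define B0 where "B0 = Mat2 b1 0 0 b2"
  define G0 where "G0 = Mat2 0 (kp * (q * b1 - p * b2)) (km * (q * b2 - p * b1)) 0"
  define Gt0 where "Gt0 = Mat2 0 (kp * (q * b2 - p * b1)) (km * (q * b1 - p * b2)) 0"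
  note matrices = A0_def B0_def G0_def Gt0_def
  have W_neg: "?r (W (- int k)) = (if k = 0 then A0 else if odd k then scalar2 a else 0)" for k
    by (simp add: aq_rep_def a_def matrices)
  have W_pos: "?r (W (int k + 1)) = (if k = 0 then B0 else if even k then scalar2 a else 0)" for k
    by (simp add: aq_rep_def a_def matrices)
  have W_0: "?r (W 0) = A0" and W_1: "?r (W 1) = B0" by (simp_all add: aq_rep_def matrices)
  have W_down: "?r (W (- int k - 1)) = (if even k then scalar2 a else 0)" for k
    by (simp add: aq_rep_def a_def matrices)
  have W_up: "?r (W (int k + 2)) = (if odd k then scalar2 a else 0)" for k
    by (simp add: aq_rep_def a_def matrices)
  have G: "?r (G k) = (if k = 0 then G0 else 0)" and Gt: "?r (Gt k) = (if k = 0 then Gt0 else 0)" for k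
    by (simp_all add: aq_rep_def p_def matrices)
  note vals = W_neg W_pos W_0 W_1 W_down W_up G Gt
  have comm: "mat2.free_eval ?r (comm u v)
      = mat2.free_eval ?r u * mat2.free_eval ?r v - mat2.free_eval ?r v * mat2.free_eval ?r u" for u v
    by (simp add: comm_def mat2.free_eval_hom)
  have qcomm: "mat2.free_eval ?r (qcomm q u v)
      = scalar2 q * mat2.free_eval ?r u * mat2.free_eval ?r v
        - scalar2 p * mat2.free_eval ?r v * mat2.free_eval ?r u" for u v
    by (simp add: qcomm_def mat2.free_eval_hom p_def)
  have sc: "A0 * scalar2 a = scalar2 a * A0" "B0 * scalar2 a = scalar2 a * B0"
    "G0 * scalar2 a = scalar2 a * G0" "Gt0 * scalar2 a = scalar2 a * Gt0"
    by (rule mat2.scal_central[symmetric])+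
  have n1: "A0 * B0 = B0 * A0 + scalar2 (1 / (q + p)) * (Gt0 - G0)"
    using s0 by (simp add: matrices scalar2_def field_simps)
  \<comment> \<open>the diagonal entries of \<open>[W\<^sub>0, G\<^sub>1]\<^sub>q\<close> and \<open>[Gt\<^sub>1, W\<^sub>0]\<^sub>q\<close>; they determine the scalar \<open>a\<close>\<close>
  have diag: "q * x * (y * (q * d - p * b)) - p * (x * (q * b - p * d)) * y = x * y * (q + p)^2 * (a - b)"
    if "b + d = b1 + b2" for x y b d
  proof -
    have "(q + p)^2 = q^2 + p^2 + 2"
      using qp by (simp add: power2_sum)
    then have "(q + p)^2 * (a - b) = (q^2 + p^2) * d - 2 * b"
      using a[folded that] by (simp add: algebra_simps)
    moreover have "q * x * (y * (q * d - p * b)) - p * (x * (q * b - p * d)) * y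
        = x * y * ((q^2 + p^2) * d - 2 * (q * p) * b)"
      by (simp add: power2_eq_square algebra_simps)
    ultimately show ?thesis
      using qp by (simp add: mult.assoc)
  qed
  \<comment> \<open>the off-diagonal entries of \<open>[G\<^sub>1, W\<^sub>1]\<^sub>q\<close> and \<open>[W\<^sub>1, Gt\<^sub>1]\<^sub>q\<close>; this is where the conic enters\<close>
  have off: "q * (x * (q * b - p * d)) * d - p * b * (x * (q * b - p * d)) = - (kp * km * (q + p)^2 * x)"
    if "b^2 + d^2 - (q^2 + p^2) * b * d = kp * km * (q + p)^2" for x b d
  proof -
    have "q * (x * (q * b - p * d)) * d - p * b * (x * (q * b - p * d))
        = x * ((q^2 + p^2) * b * d - (q * p) * (b^2 + d^2))"
      by (simp add: power2_eq_square algebra_simps)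
    moreover have "(q^2 + p^2) * b * d - (b^2 + d^2) = - (kp * km * (q + p)^2)"
      using that by (metis minus_diff_eq)
    ultimately show ?thesis
      using qp by (simp add: mult.commute)
  qed
  have n2: "scalar2 q * A0 * G0 - scalar2 p * G0 * A0 = scalar2 (rho q kp km) * (scalar2 a - B0)"
    and n3: "scalar2 q * Gt0 * A0 - scalar2 p * A0 * Gt0 = scalar2 (rho q kp km) * (scalar2 a - B0)"
    using diag[of b1 b2 kp km] diag[of b2 b1 km kp]
    by (simp_all add: matrices scalar2_def rho_def p_def[symmetric] mult_ac)
  have n4: "scalar2 q * G0 * B0 - scalar2 p * B0 * G0 = scalar2 (rho q kp km) * (0 - A0)"
    and n5: "scalar2 q * B0 * Gt0 - scalar2 p * Gt0 * B0 = scalar2 (rho q kp km) * (0 - A0)"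
    using off[of b1 b2 kp] off[of b2 b1 km] off[of b2 b1 kp] off[of b1 b2 km] c
    by (simp_all add: zero_mat2_def matrices scalar2_def rho_def p_def[symmetric] mult_ac add_ac)
  from rel show ?thesis
    unfolding aq_rels_def Let_def
    by (auto simp: comm qcomm mat2.free_eval_hom vals n1 n2 n3 n4 n5 sc p_def[symmetric])
qed

section \<open>The exchange relations\<close>

text \<open>
  A representative of \<open>I\<^bsub>2k+1\<^esub>\<close> in the free algebra, parametrised by its coefficients: \<open>a\<close>, \<open>b\<close> stand for
  the barred epsilons and \<open>c\<close>, \<open>d\<close> for the quotients \<open>bm / km\<close>, \<open>bp / kp\<close>.
\<close>

definition I_free :: "complex \<Rightarrow> complex \<Rightarrow> complex \<Rightarrow> complex \<Rightarrow> complex \<Rightarrow> nat \<Rightarrow> aq_gen free_alg"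
  where "I_free q a b c d k = const a * gen (W (- int k)) + const b * gen (W (int k + 1))
    + const (1 / (q^2 - inverse q ^ 2)) * (const c * gen (G k) + const d * gen (Gt k))"

lemma I_odd_eq_cls:
  "I_odd q kp km ep em bp bm k = cls (aq_rels q kp km) (I_free q ep em (bm / km) (bp / kp) k)"
  by (simp only: I_odd_def I_free_def Aq_def aq_el_def Let_def cls_hom(3,4))

lemma exchange_iff_cls:
  "aq_el q kp km (W 1) \<otimes>\<^bsub>Aq q kp km\<^esub> I_odd q kp km ep em bp bm k =
     I_odd q kp km ep' em' bp' bm' k \<otimes>\<^bsub>Aq q kp km\<^esub> aq_el q kp km (W 1) \<longleftrightarrow>
   cls (aq_rels q kp km) (gen (W 1) * I_free q ep em (bm / km) (bp / kp) k) =
     cls (aq_rels q kp km) (I_free q ep' em' (bm' / km) (bp' / kp) k * gen (W 1))"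
  by (simp only: I_odd_eq_cls Aq_def aq_el_def cls_hom)

text \<open>
  The upper left and the upper right entry of the exchange relation for \<open>k = 0\<close>, the latter
  divided by \<open>kp\<close>. The lower left entry adds nothing: up to the factor \<open>km\<close> it is the upper right
  one with \<open>b1\<close> and \<open>b2\<close> interchanged.
\<close>

lemma aq_rep_exchange:
  assumes q: "q \<noteq> 0" "q + inverse q \<noteq> 0" and kp: "kp \<noteq> 0"
    and conic: "b1^2 + b2^2 - (q^2 + inverse q^2) * b1 * b2 = kp * km * (q + inverse q)^2"
    and exch: "cls (aq_rels q kp km) (gen (W 1) * I_free q a b c d 0) =
      cls (aq_rels q kp km) (I_free q a' b' c' d' 0 * gen (W 1))"
  defines "K \<equiv> 1 / (q^2 - inverse q ^ 2)"
  shows "b * b1^2 = b' * b1^2"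
    and "b1 * (a + K * (c * (q * b1 - inverse q * b2) + d * (q * b2 - inverse q * b1))) =
      (a' + K * (c' * (q * b1 - inverse q * b2) + d' * (q * b2 - inverse q * b1))) * b2"
proof -
  define g where "g = q * b1 - inverse q * b2"
  define h where "h = q * b2 - inverse q * b1"
  have *: "mat2.free_eval (aq_rep q kp km b1 b2) (gen (W 1) * I_free q a b c d 0) =
      mat2.free_eval (aq_rep q kp km b1 b2) (I_free q a' b' c' d' 0 * gen (W 1))"
    by (rule mat2.free_eval_respects_cls[OF aq_rep_relations[OF q conic] exch])
  have "b1 * (b * b1) = b' * b1 * b1
      \<and> b1 * (a * kp + K * (c * (kp * g) + d * (kp * h)))
        = (a' * kp + K * (c' * (kp * g) + d' * (kp * h))) * b2"
    using * unfolding I_free_def mat2.free_eval_hom K_def[symmetric]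
    by (simp add: aq_rep_def scalar2_def g_def[symmetric] h_def[symmetric])
  moreover have "b1 * (a * kp + K * (c * (kp * g) + d * (kp * h)))
      = kp * (b1 * (a + K * (c * g + d * h)))"
    "(a' * kp + K * (c' * (kp * g) + d' * (kp * h))) * b2
      = kp * ((a' + K * (c' * g + d' * h)) * b2)"
    by (simp_all add: algebra_simps)
  ultimately have "b1 * (b * b1) = b' * b1 * b1"
    "b1 * (a + K * (c * g + d * h)) = (a' + K * (c' * g + d' * h)) * b2"
    using kp by simp_all
  then show "b * b1^2 = b' * b1^2"
    "b1 * (a + K * (c * (q * b1 - inverse q * b2) + d * (q * b2 - inverse q * b1))) =
      (a' + K * (c' * (q * b1 - inverse q * b2) + d' * (q * b2 - inverse q * b1))) * b2"
    by (simp_all add: g_def h_def power2_eq_square)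
qed

lemma exchange_imp_parameters:
  assumes q: "q \<noteq> 0" "q^2 \<noteq> 1" "q^2 \<noteq> -1" and kp: "kp \<noteq> 0" and km: "km \<noteq> 0"
    and exch: "cls (aq_rels q kp km) (gen (W 1) * I_free q a b c d 0) =
      cls (aq_rels q kp km) (I_free q a' b' c' d' 0 * gen (W 1))"
  shows "a = 0 \<and> a' = 0 \<and> b' = b \<and> d = c * q^2 \<and> d' = c \<and> c' = c * q^2"
proof -
  define p where "p = inverse q"
  have qp: "q * p = 1" using q by (simp add: p_def)
  have "q * (q + p) = q^2 + 1" "q * (q - p) = q^2 - 1"
    using qp by (simp_all add: power2_eq_square distrib_left right_diff_distrib)
  then have s0: "q + p \<noteq> 0" and d0: "q - p \<noteq> 0"
    using q by (auto simp: add_eq_0_iff2)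
  define K where "K = 1 / (q^2 - p^2)"
  have "q^2 - p^2 = (q + p) * (q - p)" by (simp add: power2_eq_square algebra_simps)
  then have K0: "K \<noteq> 0" using s0 d0 by (simp add: K_def)
  define r where "r = csqrt (kp * km * (q + p)^2)"
  have r: "r^2 = kp * km * (q + p)^2" by (simp add: r_def)
  have r0: "r \<noteq> 0" using kp km s0 r by auto
  \<comment> \<open>chosen so that \<open>(t, t)\<close> lies on the conic, as \<open>2 - q\<^sup>2 - p\<^sup>2 = - (q - p)\<^sup>2\<close>\<close>
  define t where "t = csqrt (- (r^2 / (q - p)^2))"
  have t: "t^2 * (q - p)^2 = - (r^2)" using d0 by (simp add: t_def)
  have t0: "t \<noteq> 0" using t r0 by auto
  have point: "b * b1^2 = b' * b1^2"
      "b1 * (a + K * (c * (q * b1 - p * b2) + d * (q * b2 - p * b1))) =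
      (a' + K * (c' * (q * b1 - p * b2) + d' * (q * b2 - p * b1))) * b2"
    if "b1^2 + b2^2 - (q^2 + p^2) * b1 * b2 = r^2" for b1 b2
    using aq_rep_exchange[OF q(1) s0[unfolded p_def] kp, of b1 b2 km a b c d a' b' c' d'] exch that
    by (simp_all add: r K_def p_def)
  have sum_diff: "u = 0 \<and> v = 0" if "u + v = 0" "u - v = 0" for u v :: complex
    using that by simp
  have "b' = b"
    using point(1)[of r 0] r0 by simp
  have "a + K * r * (c * q - d * p) = 0" "a - K * r * (c * q - d * p) = 0"
    using point(2)[of r 0] point(2)[of "- r" 0] r0 by (auto simp: algebra_simps)
  then have "a = 0" "K * r * (c * q - d * p) = 0" using sum_diff by blast+
  then have cd: "c * q = d * p" using K0 r0 by auto
  have "a' + K * r * (d' * q - c' * p) = 0" "a' - K * r * (d' * q - c' * p) = 0"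
    using point(2)[of 0 r] point(2)[of 0 "- r"] r0 by (auto simp: algebra_simps)
  then have "a' = 0" "K * r * (d' * q - c' * p) = 0" using sum_diff by blast+
  then have cd': "d' * q = c' * p" using K0 r0 by auto
  have "t^2 + t^2 - (q^2 + p^2) * t * t = - (t^2 * (q - p)^2)"
    using qp by (simp add: power2_eq_square algebra_simps)
  then have "t * (K * ((q - p) * t) * (c + d)) = t * (K * ((q - p) * t) * (c' + d'))"
    using point(2)[of t t] t \<open>a = 0\<close> \<open>a' = 0\<close> by (simp add: algebra_simps)
  then have sum: "c + d = c' + d'"
    using K0 t0 d0 by simp
  have d: "d = c * q^2" and c': "c' = d' * q^2"
    using arg_cong[OF cd, of "\<lambda>x. x * q"] arg_cong[OF cd', of "\<lambda>x. x * q"] qp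
    by (simp_all add: power2_eq_square mult.assoc mult.commute[of p q])
  have "(1 + q^2) * (c - d') = 0"
    using sum d c' by (simp add: algebra_simps)
  then have "d' = c"
    using q(3) by (auto simp: add_eq_0_iff)
  then show ?thesis
    using \<open>a = 0\<close> \<open>a' = 0\<close> \<open>b' = b\<close> d c' by simp
qed

lemma const_simps:
  "const x * const y = const (x * y)" "const x * (const y * z) = const (x * y) * z"
  "const (- x) = - const x" "const 0 = 0"
  by (simp_all add: const_def mult_single single_uminus flip: mult.assoc)

lemma gen_const:
  "gen g * const c = const c * gen g" "gen g * (const c * z) = const c * (gen g * z)"
proof -
  show *: "gen g * const c = const c * gen g"
    by (simp add: gen_def const_def mult_single)
  show "gen g * (const c * z) = const c * (gen g * z)"
    by (metis * mult.assoc)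
qed

lemma parameters_imp_exchange:
  assumes "q \<noteq> 0"
  shows "cls (aq_rels q kp km) (gen (W 1) * I_free q 0 b c (c * q^2) k) =
      cls (aq_rels q kp km) (I_free q 0 b (c * q^2) c k * gen (W 1))"
proof -
  interpret J: ideal "rel_ideal (aq_rels q kp km)" FA by (rule ideal_rel_ideal)
  define K where "K = 1 / (q^2 - inverse q ^ 2)"
  let ?w = "gen (W 1)" and ?v = "gen (W (int k + 1))" and ?g = "gen (G k)" and ?h = "gen (Gt k)"
  let ?X = "const (rho q kp km) * (gen (W (int k + 2)) - gen (W (- int k)))"
  have "(comm ?v ?w, 0) \<in> aq_rels q kp km"
    unfolding aq_rels_def Let_def by (intro UnI2 UN_I[of k] UN_I[of 0]) simp_all
  moreover have "(qcomm q ?g ?w, ?X) \<in> aq_rels q kp km" "(qcomm q ?w ?h, ?X) \<in> aq_rels q kp km"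
    unfolding aq_rels_def Let_def by (intro UnI1 UN_I[of k]; simp)+
  ultimately have rels: "comm ?v ?w - 0 \<in> rel_ideal (aq_rels q kp km)"
      "qcomm q ?g ?w - ?X \<in> rel_ideal (aq_rels q kp km)"
      "qcomm q ?w ?h - ?X \<in> rel_ideal (aq_rels q kp km)"
    unfolding cls_eq_iff[symmetric] by (simp_all only: cls_relation)
  have mult_mem: "x * y \<in> rel_ideal (aq_rels q kp km)" if "y \<in> rel_ideal (aq_rels q kp km)" for x y
    using J.I_l_closed[OF that, of x] by simp
  have add_mem: "x + y \<in> rel_ideal (aq_rels q kp km)"
    if "x \<in> rel_ideal (aq_rels q kp km)" "y \<in> rel_ideal (aq_rels q kp km)" for x y
    using additive_subgroup.a_closed[OF ideal.axioms(1)[OF ideal_rel_ideal] that] by simp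
  have "const (- b) * comm ?v ?w + (const (- K * c * q) * (qcomm q ?g ?w - ?X)
      + const (K * c * q) * (qcomm q ?w ?h - ?X)) \<in> rel_ideal (aq_rels q kp km)"
    using rels by (intro add_mem mult_mem) simp_all
  \<comment> \<open>the contributions \<open>?X\<close> of the last two relators cancel\<close>
  also have "const (- b) * comm ?v ?w + (const (- K * c * q) * (qcomm q ?g ?w - ?X)
      + const (K * c * q) * (qcomm q ?w ?h - ?X))
    = ?w * I_free q 0 b c (c * q^2) k - I_free q 0 b (c * q^2) c k * ?w"
    using assms unfolding I_free_def K_def[symmetric] comm_def qcomm_def
    by (simp add: algebra_simps const_simps gen_const power2_eq_square)
  finally show ?thesis
    by (simp add: cls_eq_iff)
qed

theorem proposition6p2:
  fixes q kp km ep em bp bm ep' em' bp' bm' :: complex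
  assumes "q \<noteq> 0" and "\<And>n::nat. n > 0 \<Longrightarrow> q ^ n \<noteq> 1"
    and "kp \<noteq> 0" and "km \<noteq> 0"
  shows "(\<forall>k::nat.
            aq_el q kp km (W 1) \<otimes>\<^bsub>Aq q kp km\<^esub> I_odd q kp km ep em bp bm k =
            I_odd q kp km ep' em' bp' bm' k \<otimes>\<^bsub>Aq q kp km\<^esub> aq_el q kp km (W 1)) \<longleftrightarrow>
         (ep' = ep \<and> ep = 0 \<and> em' = em \<and> bp / kp = bm / km * q^2 \<and>
          bp' = bp * q powi (-2) \<and> bm' = bm * q powi 2)"
    (is "?exchange \<longleftrightarrow> ?params")
proof
  assume ?exchange
  moreover have "q^2 \<noteq> 1" using assms(2)[of 2] by simp
  moreover have "q^2 \<noteq> -1"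
  proof
    assume "q^2 = -1"
    then have "q^4 = 1" using power_mult[of q 2 2] by simp
    then show False using assms(2)[of 4] by simp
  qed
  ultimately have "ep = 0 \<and> ep' = 0 \<and> em' = em \<and> bp / kp = bm / km * q^2
      \<and> bp' / kp = bm / km \<and> bm' / km = bm / km * q^2"
    using assms unfolding exchange_iff_cls by (intro exchange_imp_parameters[of q kp km]) auto
  moreover from this have "bp / kp = bp' / kp * q^2"
    by simp
  ultimately show ?params
    using assms by (auto simp: power_int_minus field_simps)
next
  assume p: ?params
  then have "bp' / kp = bm / km" "bm' / km = bm / km * q^2"
    using assms by (auto simp: power_int_minus field_simps)
  with p show ?exchange
    using parameters_imp_exchange[OF assms(1), of kp km em "bm / km"] unfolding exchange_iff_cls by simp
qed

end
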